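(* Let $q\ge 2$, let $x,y\in\Sigma_q^n$, and let $1\le s\le t\le n$ be integers. If \[ D_{s-1}(x)\cap D_{s-1}(y)=\varnothing, \] then \[ |D_t(x)\cap D_t(y)|\le \binom{2s}{s}\binom{n-s}{t-s}. \] In particular, if $s<t$ are fixed, then there exist constants $K>0$ and $n_0$, depending only on $s$ and $t$, such that for all $n\ge n_0$ (and all $x,y\in\Sigma_q^n$ with $D_{s-1}(x)\cap D_{s-1}(y)=\varnothing$), \[ |D_t(x)\cap D_t(y)|\le \frac{\binom{2s}{s}}{(t-s)!}\,n^{t-s}-K\,n^{t-s-1}. \]
   Context: $\Sigma_q$ is an alphabet of size $q\ge2$, and $\Sigma_q^n$ is the set of sequences of length $n$ over $\Sigma_q$. For sequences $w,x$, write $w\preccurlyeq x$ if $w$ is a (not necessarily contiguous) subsequence of $x$, i.e. $w$ is obtained from $x$ by deleting $|x|-|w|$ symbols. For $x\in\Sigma_q^n$ and $0\le t\le n$, the $t$-deletion ball is $D_t(x)=\{w\in\Sigma_q^{n-t}: w\preccurlyeq x\}$. *)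

theory Defs
  imports Complex_Main "HOL-Library.Sublist"
begin

text \<open>The alphabet of size \<open>q\<close> is represented by \<open>{..<q} :: nat set\<close>, so that \<open>q\<close> can be quantified
  inside a formula.\<close>

definition words :: "nat \<Rightarrow> nat \<Rightarrow> nat list set" where
  "words q n = {w. set w \<subseteq> {..<q} \<and> length w = n}"

text \<open>For \<open>t > length x\<close>, where the deletion ball is not defined in the usual convention, this
  set is empty; stating the length condition additively avoids truncated subtraction.\<close>

definition deletion_ball :: "nat \<Rightarrow> nat \<Rightarrow> nat list \<Rightarrow> nat list set" where
  "deletion_ball q t x = {w. set w \<subseteq> {..<q} \<and> length w + t = length x \<and> subseq w x}"

end

theory Submission imports Defs begin

text \<open>More generally, let \<open>|x| = L + a\<close>, \<open>|y| = L + b\<close> and suppose that no common subsequence of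
  \<open>x\<close> and \<open>y\<close> is longer than \<open>L\<close>; then at most \<open>(a + b choose a) * (L choose m)\<close> common
  subsequences have length \<open>m\<close>. Compare the first letters. If both words start with \<open>c\<close>, splitting by
  whether a common subsequence starts with \<open>c\<close> lowers \<open>L\<close> by one and gives Pascal's rule for
  \<open>L choose m\<close>. If the first letters differ, every common subsequence survives dropping one of
  them, which lowers \<open>a\<close> or \<open>b\<close> and gives Pascal's rule for \<open>a + b choose a\<close>. The theorem is
  the case \<open>L = n - s\<close>, \<open>a = b = s\<close>, \<open>m = n - t\<close>.\<close>

text \<open>Indexed by the remaining length instead of the number of deletions, because the two
  words may differ in length during the induction.\<close>

definition common_subseqs :: "'a list \<Rightarrow> 'a list \<Rightarrow> nat \<Rightarrow> 'a list set" where
  "common_subseqs x y m = {w. length w = m \<and> subseq w x \<and> subseq w y}"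

lemma finite_common_subseqs [simp]: "finite (common_subseqs x y m)"
  by (rule finite_subset [of _ "set (subseqs x)"]) (auto simp: common_subseqs_def)

lemma common_subseqs_commute: "common_subseqs x y m = common_subseqs y x m"
  by (auto simp: common_subseqs_def)

lemma common_subseqs_0 [simp]: "common_subseqs x y 0 = {[]}"
  by (auto simp: common_subseqs_def)

text \<open>A word starting with \<open>c\<close> may match that letter to both heads; a word
  starting with another letter uses neither head.\<close>

lemma common_subseqs_Cons_same:
  "common_subseqs (c # x) (c # y) (Suc m) \<subseteq>
     Cons c ` common_subseqs x y m \<union> common_subseqs x y (Suc m)"
proof
  fix w assume w: "w \<in> common_subseqs (c # x) (c # y) (Suc m)"
  then obtain e v where "w = e # v" by (cases w) (auto simp: common_subseqs_def)
  with w show "w \<in> Cons c ` common_subseqs x y m \<union> common_subseqs x y (Suc m)"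
    by (cases "e = c") (auto simp: common_subseqs_def)
qed

lemma card_common_subseqs_Cons_same_le:
  "card (common_subseqs (c # x) (c # y) (Suc m)) \<le>
     card (common_subseqs x y m) + card (common_subseqs x y (Suc m))"
proof -
  have "card (common_subseqs (c # x) (c # y) (Suc m)) \<le>
      card (Cons c ` common_subseqs x y m \<union> common_subseqs x y (Suc m))"
    by (intro card_mono common_subseqs_Cons_same) simp
  also have "\<dots> \<le> card (Cons c ` common_subseqs x y m) + card (common_subseqs x y (Suc m))"
    by (rule card_Un_le)
  also have "\<dots> = card (common_subseqs x y m) + card (common_subseqs x y (Suc m))"
    by (simp add: card_image)
  finally show ?thesis .
qed

lemma common_subseqs_Cons_diff:
  assumes "c \<noteq> d"
  shows "common_subseqs (c # x) (d # y) m \<subseteq>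
    common_subseqs x (d # y) m \<union> common_subseqs (c # x) y m"
proof
  fix w assume "w \<in> common_subseqs (c # x) (d # y) m"
  then show "w \<in> common_subseqs x (d # y) m \<union> common_subseqs (c # x) y m"
    using assms by (cases w) (auto simp: common_subseqs_def split: if_splits)
qed

lemma card_common_subseqs_Cons_diff_le:
  assumes "c \<noteq> d"
  shows "card (common_subseqs (c # x) (d # y) m) \<le>
    card (common_subseqs x (d # y) m) + card (common_subseqs (c # x) y m)"
  by (rule order_trans [OF card_mono [OF _ common_subseqs_Cons_diff [OF assms]] card_Un_le]) simp

text \<open>For equal words the heads always agree, so only the equal-head splitting occurs.\<close>

lemma card_common_subseqs_self_le: "card (common_subseqs x x m) \<le> length x choose m"
proof (induction x arbitrary: m)
  case Nil
  have "common_subseqs [] [] (Suc k) = {}" for k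
    by (auto simp: common_subseqs_def)
  then show ?case by (cases m) simp_all
next
  case (Cons c x)
  show ?case
  proof (cases m)
    case (Suc k)
    then show ?thesis
      using card_common_subseqs_Cons_same_le [of c x x k] Cons.IH [of k] Cons.IH [of "Suc k"]
      by simp
  qed simp
qed

text \<open>Settles the cases \<open>a = 0\<close> and \<open>b = 0\<close> below, where one word
  has length exactly \<open>L\<close> and \<open>a + b choose a\<close> is 1.\<close>

lemma card_common_subseqs_le_length:
  "card (common_subseqs x y m) \<le> length x choose m"
proof -
  have "card (common_subseqs x y m) \<le> card (common_subseqs x x m)"
    by (rule card_mono [OF finite_common_subseqs]) (auto simp: common_subseqs_def)
  then show ?thesis using card_common_subseqs_self_le [of x m] by simp
qed

text \<open>\<open>L\<close> need only be an upper bound, not the maximum, so it can stay fixed when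
  a head is dropped. Induction on the total length covers both the removal of two heads and the
  removal of one.\<close>

lemma card_common_subseqs_le:
  assumes "length x = L + a" "length y = L + b"
    and "\<And>w. subseq w x \<Longrightarrow> subseq w y \<Longrightarrow> length w \<le> L"
  shows "card (common_subseqs x y m) \<le> (a + b choose a) * (L choose m)"
  using assms
proof (induction "length x + length y" arbitrary: x y L a b m rule: less_induct)
  case less
  consider "a = 0" | "b = 0" | a' b' where "a = Suc a'" "b = Suc b'"
    by (cases a; cases b) auto
  then show ?case
  proof cases
    case 1
    then show ?thesis using card_common_subseqs_le_length [of x y m] less.prems by simp
  next
    case 2
    then show ?thesis
      using card_common_subseqs_le_length [of y x m] less.prems
      by (simp add: common_subseqs_commute [of x])
  next
    case (3 a' b')
    obtain c x' where x: "x = c # x'" using 3 less.prems(1) by (cases x) auto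
    obtain d y' where y: "y = d # y'" using 3 less.prems(2) by (cases y) auto
    show ?thesis
    proof (cases "c = d")
      case True
      \<comment> \<open>The common subsequence \<open>[c]\<close> forces \<open>L\<close> to be
        positive.\<close>
      obtain L' where L: "L = Suc L'"
        using less.prems(3) [of "[c]"] x y True by (cases L) auto
      \<comment> \<open>Prepending \<open>c\<close> to a common subsequence of the tails gives one
        of \<open>x\<close> and \<open>y\<close>, so the bound drops to \<open>L'\<close> while
        \<open>a\<close> and \<open>b\<close> stay.\<close>
      have IH: "card (common_subseqs x' y' k) \<le> (a + b choose a) * (L' choose k)" for k
      proof (rule less.hyps)
        fix w assume "subseq w x'" "subseq w y'"
        then show "length w \<le> L'" using less.prems(3) [of "c # w"] x y True L by simp
      qed (use less.prems x y L in auto)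
      show ?thesis
      proof (cases m)
        case 0
        then show ?thesis by (simp add: Suc_le_eq)
      next
        case (Suc k)
        have "card (common_subseqs x y m) \<le>
            (a + b choose a) * (L' choose k) + (a + b choose a) * (L' choose Suc k)"
          using card_common_subseqs_Cons_same_le [of c x' y' k] IH [of k] IH [of "Suc k"] x y True Suc
          by simp
        also have "\<dots> = (a + b choose a) * (L choose m)"
          using Suc L by (simp add: algebra_simps)
        finally show ?thesis .
      qed
    next
      case False
      have "card (common_subseqs x' y m) \<le> (a' + b choose a') * (L choose m)"
      proof (rule less.hyps)
        fix w assume "subseq w x'" "subseq w y"
        then show "length w \<le> L" using less.prems(3) [of w] x by (simp add: list_emb_Cons)
      qed (use less.prems x 3 in auto)
      moreover have "card (common_subseqs x y' m) \<le> (a + b' choose a) * (L choose m)"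
      proof (rule less.hyps)
        fix w assume "subseq w x" "subseq w y'"
        then show "length w \<le> L" using less.prems(3) [of w] y by (simp add: list_emb_Cons)
      qed (use less.prems y 3 in auto)
      moreover have "card (common_subseqs x y m) \<le>
          card (common_subseqs x' y m) + card (common_subseqs x y' m)"
        using card_common_subseqs_Cons_diff_le [OF False] x y by simp
      \<comment> \<open>Pascal's rule, using \<open>a' + b = a + b'\<close>.\<close>
      moreover have "a + b choose a = (a' + b choose a') + (a + b' choose a)"
        using 3 by simp
      ultimately show ?thesis by (simp add: algebra_simps)
    qed
  qed
qed

lemma card_deletion_ball_Int_le:
  assumes "1 \<le> s" "s \<le> t" "t \<le> n" "x \<in> words q n" "y \<in> words q n"
    and disj: "deletion_ball q (s - 1) x \<inter> deletion_ball q (s - 1) y = {}"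
  shows "card (deletion_ball q t x \<inter> deletion_ball q t y)
    \<le> ((2 * s) choose s) * ((n - s) choose (t - s))"
proof -
  have len: "length x = n" "length y = n" and "set x \<subseteq> {..<q}"
    using assms by (auto simp: words_def)
  have "length w \<le> n - s" if w: "subseq w x" "subseq w y" for w
  proof (rule ccontr)
    assume long: "\<not> length w \<le> n - s"
    \<comment> \<open>Disjointness speaks only of words of length exactly
      \<open>n - (s - 1)\<close>, so a longer common subsequence is cut to that length.\<close>
    define v where "v = take (n - s + 1) w"
    have "subseq v w"
      unfolding v_def by (simp add: prefix_imp_subseq take_is_prefix)
    then have v: "subseq v x" "subseq v y"
      using w by (auto intro: subseq_order.trans)
    moreover have "set v \<subseteq> {..<q}"
      using v(1) \<open>set x \<subseteq> {..<q}\<close> by (auto elim: list_emb_set)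
    moreover have "length v + (s - 1) = n"
      using long assms(1-3) by (simp add: v_def)
    ultimately have "v \<in> deletion_ball q (s - 1) x \<inter> deletion_ball q (s - 1) y"
      by (simp add: deletion_ball_def len)
    with disj show False by simp
  qed
  then have "card (common_subseqs x y (n - t)) \<le> (s + s choose s) * ((n - s) choose (n - t))"
    using assms(1-3) len by (intro card_common_subseqs_le) auto
  moreover have "card (deletion_ball q t x \<inter> deletion_ball q t y) \<le> card (common_subseqs x y (n - t))"
    using len
    by (intro card_mono [OF finite_common_subseqs]) (auto simp: deletion_ball_def common_subseqs_def)
  moreover have "(n - s) choose (n - t) = (n - s) choose (t - s)"
    using binomial_symmetric [of "t - s" "n - s"] assms(2,3) by simp
  ultimately show ?thesis by (simp add: mult_2)
qed

text \<open>The leading factor of the falling factorial is at most \<open>n - 1\<close> because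
  \<open>s\<close> is positive, and this yields the second-order term; the other factors are bounded
  by \<open>n\<close>.\<close>

lemma binomial_le_pow_pred:
  assumes "1 \<le> s" "s \<le> n" "0 < k"
  shows "real ((n - s) choose k) \<le> (real n ^ k - real n ^ (k - 1)) / fact k"
proof -
  obtain j where k: "k = Suc j" using assms(3) by (cases k) auto
  have "real ((n - s) choose k) * fact k = (\<Prod>i<k. real (n - s) - real i)"
    by (simp add: binomial_gbinomial gbinomial_prod_rev atLeast0LessThan)
  also have "\<dots> \<le> real (n - 1) * real n ^ j"
  \<comment> \<open>Bounding factor by factor needs nonnegative factors; if \<open>k\<close> exceeds
    \<open>n - s\<close>, the factor at \<open>i = n - s\<close> is zero.\<close>
  proof (cases "k \<le> n - s")
    case True
    have "(\<Prod>i<k. real (n - s) - real i) =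
        real (n - s) * (\<Prod>i<j. real (n - s) - real (Suc i))"
      unfolding k by (subst prod.lessThan_Suc_shift) simp
    also have "\<dots> \<le> real (n - 1) * (\<Prod>i<j. real n)"
      using True k assms by (intro mult_mono prod_mono prod_nonneg) auto
    finally show ?thesis by simp
  next
    case False
    then have "(\<Prod>i<k. real (n - s) - real i) = 0"
      by (intro prod_zero) auto
    then show ?thesis
      by (simp only: of_nat_0_le_iff mult_nonneg_nonneg zero_le_power)
  qed
  also have "\<dots> = real n ^ k - real n ^ (k - 1)"
    using assms by (simp add: k of_nat_diff algebra_simps)
  finally show ?thesis by (simp add: field_simps)
qed

theorem theorem1p1:
  fixes s t :: nat
  assumes "1 \<le> s" and "s \<le> t"
  shows "(\<forall>q n. \<forall>x \<in> words q n. \<forall>y \<in> words q n.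
            2 \<le> q \<longrightarrow> t \<le> n \<longrightarrow>
            deletion_ball q (s - 1) x \<inter> deletion_ball q (s - 1) y = {} \<longrightarrow>
            card (deletion_ball q t x \<inter> deletion_ball q t y)
              \<le> ((2 * s) choose s) * ((n - s) choose (t - s)))
       \<and> (s < t \<longrightarrow>
           (\<exists>K :: real. K > 0 \<and> (\<exists>n0 :: nat.
             \<forall>q \<ge> 2. \<forall>n \<ge> n0. \<forall>x \<in> words q n. \<forall>y \<in> words q n.
               deletion_ball q (s - 1) x \<inter> deletion_ball q (s - 1) y = {} \<longrightarrow>
               real (card (deletion_ball q t x \<inter> deletion_ball q t y))
                 \<le> real ((2 * s) choose s) / fact (t - s) * real n ^ (t - s)
                    - K * real n ^ (t - s - 1))))"
proof (intro conjI impI allI ballI)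
  fix q n x y
  assume "x \<in> words q n" "y \<in> words q n" "t \<le> n"
    and "deletion_ball q (s - 1) x \<inter> deletion_ball q (s - 1) y = {}"
  then show "card (deletion_ball q t x \<inter> deletion_ball q t y)
      \<le> ((2 * s) choose s) * ((n - s) choose (t - s))"
    using assms by (intro card_deletion_ball_Int_le)
next
  assume "s < t"
  \<comment> \<open>The leading coefficient itself serves as \<open>K\<close>, and \<open>t\<close>
    as \<open>n0\<close>.\<close>
  let ?C = "real ((2 * s) choose s) / fact (t - s)"
  have "?C > 0" by simp
  moreover have "real (card (deletion_ball q t x \<inter> deletion_ball q t y))
      \<le> ?C * real n ^ (t - s) - ?C * real n ^ (t - s - 1)"
    if "t \<le> n" "x \<in> words q n" "y \<in> words q n"
      "deletion_ball q (s - 1) x \<inter> deletion_ball q (s - 1) y = {}" for q n x y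
  proof -
    have "real (card (deletion_ball q t x \<inter> deletion_ball q t y))
        \<le> real (((2 * s) choose s) * ((n - s) choose (t - s)))"
      using card_deletion_ball_Int_le [OF assms that] by (rule of_nat_mono)
    also have "\<dots> = real ((2 * s) choose s) * real ((n - s) choose (t - s))"
      by simp
    also have "\<dots> \<le> real ((2 * s) choose s) *
        ((real n ^ (t - s) - real n ^ (t - s - 1)) / fact (t - s))"
      using assms \<open>s < t\<close> that by (intro mult_left_mono binomial_le_pow_pred) auto
    finally show ?thesis by (simp add: algebra_simps diff_divide_distrib)
  qed
  ultimately show "\<exists>K :: real. K > 0 \<and> (\<exists>n0 :: nat.
      \<forall>q \<ge> 2. \<forall>n \<ge> n0. \<forall>x \<in> words q n. \<forall>y \<in> words q n.
        deletion_ball q (s - 1) x \<inter> deletion_ball q (s - 1) y = {} \<longrightarrow>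
        real (card (deletion_ball q t x \<inter> deletion_ball q t y))
          \<le> ?C * real n ^ (t - s) - K * real n ^ (t - s - 1))"
    by blast
qed

end
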